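(* Let $\alpha$ be a positive rational number. If $\mathcal T_1$ and $\mathcal T_2$ are maximal primitive factorization trees for $\alpha$, then $\mathcal T_1\cong\mathcal T_2$.
   Context: Write $\alpha=a/b$ with $a,b$ coprime positive integers. Let $p_1\ge\cdots\ge p_N$ be the primes dividing $ab$, listed with multiplicity. Put $\gamma(i)=1$ if $p_i\mid a$, $\gamma(i)=-1$ if $p_i\mid b$, and $\alpha_n=\prod_{i=1}^n p_i^{\gamma(i)}$ for $0\le n\le N$. A factorization of a positive rational $\beta$ is a sequence $(a_1/b_1,a_2/b_2,\dots)$ with $a_i,b_i$ positive integers, $a_i=b_i=1$ for all but finitely many $i$, $\prod_i a_i/b_i=\beta$, $\max\{a_i,b_i\}\ge\max\{a_{i+1},b_{i+1}\}$ for all $i$, and $\gcd(a_i,b_j)=1$ for all $i,j$. Let $\mathfrak F_\alpha$ be the set of factorizations of $\alpha_n$, $0\le n\le N$. For $0\le n<N$, a factorization $(a_i/b_i)$ of $\alpha_n$ is a direct subfactorization of a factorization $(c_i/d_i)$ of $\alpha_{n+1}$ if either $p_{n+1}\mid a$ and for some $k$: $d_i=b_i$ for all $i$, $c_i=a_i$ for $i\ne k$, $c_k=a_kp_{n+1}$; or $p_{n+1}\mid b$ and for some $k$: $c_i=a_i$ for all $i$, $d_i=b_i$ for $i\ne k$, $d_k=b_kp_{n+1}$. A tree data structure for a set $X$ is a pair $(T,\nu)$ with $T$ a rooted tree (digraph with edges from each vertex to its children) and $\nu:V(T)\to X$ a map; $\phi$ is the parenting map and $\mathcal C(r)$ the set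 of children of $r$. A factorization tree for $\alpha$ is a tree data structure $(T,\nu)$ for $\mathfrak F_\alpha$ with: (1) root $r_0$ has $\nu(r_0)=(1,1,\dots)$; (2) if $n<N$ and $\nu(r)$ is a factorization of $\alpha_n$ then $r$ has a child; (3) $\nu(r)=\nu(s)$ and $\phi(r)=\phi(s)$ imply $r=s$; (4) for non-root $r$, $\nu(\phi(r))$ is a direct subfactorization of $\nu(r)$. For $0\le n<N$ and a factorization $\mathbf A=(a_1/b_1,\dots,a_\ell/b_\ell,1,1,\dots)$ of $\alpha_n$ with $a_\ell/b_\ell\ne1$ (with $\ell=0$ if $\mathbf A=(1,1,\dots)$): if $p_{n+1}\mid a$, let $\delta(\mathbf A)$ be the set of sequences obtained from $\mathbf A$ by replacing the entry $a_k/b_k$ by $a_kp_{n+1}/b_k$ for some index $k$ with $a_kp_{n+1}<b_k$, and let $\epsilon(\mathbf A)=\{(a_1/b_1,\dots,a_\ell/b_\ell,p_{n+1}/1,1,1,\dots)\}$; if $p_{n+1}\mid b$, let $\delta(\mathbf A)$ consist of the sequences obtained by replacing $a_k/b_k$ by $a_k/(b_kp_{n+1})$ for some $k$ with $b_kp_{n+1}<a_k$, and $\epsilon(\mathbf A)=\{(a_1/b_1,\dots,a_\ell/b_\ell,1/p_{n+1},1,1,\dots)\}$. Set $\Delta(\mathbf A)=\delta(\mathbf A)\cup\epsilon(\mathbf A)$. A maximal primitive factorization tree for $\alpha$ is a factorization tree $(T,\nu)$ for $\alpha$ such that $\nu(\mathcal C(r))=\Delta(\nu(r))$ for every non-leaf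 vertex $r$. An isomorphism $(T_1,\nu_1)\to(T_2,\nu_2)$ is a bijection $\sigma:V(T_1)\to V(T_2)$ with $\nu_2\circ\sigma=\nu_1$ and $(g,h)\in E(T_1)\iff(\sigma(g),\sigma(h))\in E(T_2)$; $\cong$ means an isomorphism exists. *)

theory Defs
  imports "HOL-Computational_Algebra.Primes" "Graph_Theory.Pair_Digraph"
begin

section \<open>Factorizations\<close>

text \<open>A positive rational number in lowest terms: \<open>\<alpha> = num \<alpha> / den \<alpha>\<close>.\<close>

definition num :: "rat \<Rightarrow> nat" where
  "num \<alpha> = nat (fst (quotient_of \<alpha>))"

definition den :: "rat \<Rightarrow> nat" where
  "den \<alpha> = nat (snd (quotient_of \<alpha>))"

text \<open>
  The primes dividing \<open>num \<alpha> * den \<alpha>\<close>, with multiplicity and in non-increasing order.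
  Lists and sequences are indexed from 0, so \<open>primes_of \<alpha> ! n\<close> is the prime written
  \<open>p\<^sub>n\<^sub>+\<^sub>1\<close> in the usual numbering from 1.
\<close>

definition primes_of :: "rat \<Rightarrow> nat list" where
  "primes_of \<alpha> = rev (sorted_list_of_multiset (prime_factorization (num \<alpha> * den \<alpha>)))"

abbreviation num_primes :: "rat \<Rightarrow> nat" where
  "num_primes \<alpha> \<equiv> length (primes_of \<alpha>)"

definition prime_sign :: "rat \<Rightarrow> nat \<Rightarrow> int" where
  "prime_sign \<alpha> i = (if primes_of \<alpha> ! i dvd num \<alpha> then 1 else -1)"

definition partial_rat :: "rat \<Rightarrow> nat \<Rightarrow> rat" where
  "partial_rat \<alpha> n = (\<Prod>i<n. of_nat (primes_of \<alpha> ! i) powi prime_sign \<alpha> i)"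

text \<open>
  The entry \<open>a\<^sub>i / b\<^sub>i\<close> of a factorization is encoded as the pair \<open>(a\<^sub>i, b\<^sub>i)\<close>. The coprimality
  condition (with \<open>i = j\<close>) says that it is in lowest terms, so that pairs and rational
  entries determine each other.
\<close>

type_synonym fac = "nat \<Rightarrow> nat \<times> nat"

abbreviation (input) nmr :: "fac \<Rightarrow> nat \<Rightarrow> nat" where "nmr A i \<equiv> fst (A i)"
abbreviation (input) dnm :: "fac \<Rightarrow> nat \<Rightarrow> nat" where "dnm A i \<equiv> snd (A i)"

definition is_factorization :: "rat \<Rightarrow> fac \<Rightarrow> bool" where
  "is_factorization \<beta> A \<longleftrightarrow>
     (\<forall>i. nmr A i > 0 \<and> dnm A i > 0) \<and>
     finite {i. A i \<noteq> (1, 1)} \<and>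
     (\<Prod>i\<in>{i. A i \<noteq> (1, 1)}. of_nat (nmr A i) / of_nat (dnm A i)) = \<beta> \<and>
     (\<forall>i. max (nmr A i) (dnm A i) \<ge> max (nmr A (Suc i)) (dnm A (Suc i))) \<and>
     (\<forall>i j. coprime (nmr A i) (dnm A j))"

definition factorizations :: "rat \<Rightarrow> fac set" where
  "factorizations \<alpha> = {A. \<exists>n\<le>num_primes \<alpha>. is_factorization (partial_rat \<alpha> n) A}"

definition direct_subfactorization :: "rat \<Rightarrow> fac \<Rightarrow> fac \<Rightarrow> bool" where
  "direct_subfactorization \<alpha> A C \<longleftrightarrow>
     (\<exists>n<num_primes \<alpha>.
        is_factorization (partial_rat \<alpha> n) A \<and>
        is_factorization (partial_rat \<alpha> (Suc n)) C \<and>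
        (let p = primes_of \<alpha> ! n in
           (p dvd num \<alpha> \<and>
              (\<exists>k. (\<forall>i. dnm C i = dnm A i) \<and> (\<forall>i. i \<noteq> k \<longrightarrow> nmr C i = nmr A i) \<and>
                   nmr C k = nmr A k * p)) \<or>
           (p dvd den \<alpha> \<and>
              (\<exists>k. (\<forall>i. nmr C i = nmr A i) \<and> (\<forall>i. i \<noteq> k \<longrightarrow> dnm C i = dnm A i) \<and>
                   dnm C k = dnm A k * p))))"

text \<open>The number \<open>\<ell>\<close> of entries up to the last one different from 1.\<close>

definition fac_length :: "fac \<Rightarrow> nat" where
  "fac_length A = (LEAST l. \<forall>i\<ge>l. A i = (1, 1))"

text \<open>
  In the following three definitions \<open>n < num_primes \<alpha>\<close> and \<open>A\<close> is meant to be a factorization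
  of \<open>partial_rat \<alpha> n\<close> (which determines \<open>n\<close>).
\<close>

definition delta :: "rat \<Rightarrow> nat \<Rightarrow> fac \<Rightarrow> fac set" where
  "delta \<alpha> n A = (let p = primes_of \<alpha> ! n in
     if p dvd num \<alpha>
     then {A(k := (nmr A k * p, dnm A k)) | k. nmr A k * p < dnm A k}
     else {A(k := (nmr A k, dnm A k * p)) | k. dnm A k * p < nmr A k})"

definition epsilon :: "rat \<Rightarrow> nat \<Rightarrow> fac \<Rightarrow> fac set" where
  "epsilon \<alpha> n A = (let p = primes_of \<alpha> ! n in
     if p dvd num \<alpha>
     then {A(fac_length A := (p, 1))}
     else {A(fac_length A := (1, p))})"

definition Delta :: "rat \<Rightarrow> nat \<Rightarrow> fac \<Rightarrow> fac set" where
  "Delta \<alpha> n A = delta \<alpha> n A \<union> epsilon \<alpha> n A"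


section \<open>Factorization trees\<close>

definition rooted_tree :: "'v pair_pre_digraph \<Rightarrow> 'v \<Rightarrow> bool" where
  "rooted_tree T r0 \<longleftrightarrow>
     pair_wf_digraph T \<and> r0 \<in> pverts T \<and>
     (\<forall>v\<in>pverts T. \<exists>!w. pre_digraph.awalk (with_proj T) r0 w v)"

definition children :: "'v pair_pre_digraph \<Rightarrow> 'v \<Rightarrow> 'v set" where
  "children T r = {s. (r, s) \<in> parcs T}"

text \<open>Only meaningful for a vertex other than the root.\<close>

definition parent :: "'v pair_pre_digraph \<Rightarrow> 'v \<Rightarrow> 'v" where
  "parent T r = (THE q. (q, r) \<in> parcs T)"

definition tree_data_structure ::
  "'x set \<Rightarrow> 'v pair_pre_digraph \<Rightarrow> 'v \<Rightarrow> ('v \<Rightarrow> 'x) \<Rightarrow> bool" where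
  "tree_data_structure X T r0 \<nu> \<longleftrightarrow> rooted_tree T r0 \<and> (\<forall>v\<in>pverts T. \<nu> v \<in> X)"

definition factorization_tree ::
  "rat \<Rightarrow> 'v pair_pre_digraph \<Rightarrow> 'v \<Rightarrow> ('v \<Rightarrow> fac) \<Rightarrow> bool" where
  "factorization_tree \<alpha> T r0 \<nu> \<longleftrightarrow>
     tree_data_structure (factorizations \<alpha>) T r0 \<nu> \<and>
     \<nu> r0 = (\<lambda>_. (1, 1)) \<and>
     (\<forall>r\<in>pverts T. \<forall>n<num_primes \<alpha>.
        is_factorization (partial_rat \<alpha> n) (\<nu> r) \<longrightarrow> children T r \<noteq> {}) \<and>
     (\<forall>r\<in>pverts T - {r0}. \<forall>s\<in>pverts T - {r0}.
        \<nu> r = \<nu> s \<and> parent T r = parent T s \<longrightarrow> r = s) \<and>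
     (\<forall>r\<in>pverts T - {r0}. direct_subfactorization \<alpha> (\<nu> (parent T r)) (\<nu> r))"

text \<open>
  For a non-leaf vertex \<open>r\<close> of a factorization tree, an \<open>n\<close> as in the last condition exists,
  because \<open>\<nu> r\<close> is a direct subfactorization of the label of a child.
\<close>

definition maximal_primitive_factorization_tree ::
  "rat \<Rightarrow> 'v pair_pre_digraph \<Rightarrow> 'v \<Rightarrow> ('v \<Rightarrow> fac) \<Rightarrow> bool" where
  "maximal_primitive_factorization_tree \<alpha> T r0 \<nu> \<longleftrightarrow>
     factorization_tree \<alpha> T r0 \<nu> \<and>
     (\<forall>r\<in>pverts T. children T r \<noteq> {} \<longrightarrow>
        (\<forall>n<num_primes \<alpha>. is_factorization (partial_rat \<alpha> n) (\<nu> r) \<longrightarrow>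
           \<nu> ` children T r = Delta \<alpha> n (\<nu> r)))"

definition tree_isomorphism ::
  "('v \<Rightarrow> 'w) \<Rightarrow> 'v pair_pre_digraph \<Rightarrow> ('v \<Rightarrow> 'x) \<Rightarrow> 'w pair_pre_digraph \<Rightarrow> ('w \<Rightarrow> 'x) \<Rightarrow> bool" where
  "tree_isomorphism \<sigma> T1 \<nu>1 T2 \<nu>2 \<longleftrightarrow>
     bij_betw \<sigma> (pverts T1) (pverts T2) \<and>
     (\<forall>v\<in>pverts T1. \<nu>2 (\<sigma> v) = \<nu>1 v) \<and>
     (\<forall>g\<in>pverts T1. \<forall>h\<in>pverts T1. (g, h) \<in> parcs T1 \<longleftrightarrow> (\<sigma> g, \<sigma> h) \<in> parcs T2)"

definition tree_isomorphic ::
  "'v pair_pre_digraph \<Rightarrow> ('v \<Rightarrow> 'x) \<Rightarrow> 'w pair_pre_digraph \<Rightarrow> ('w \<Rightarrow> 'x) \<Rightarrow> bool" where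
  "tree_isomorphic T1 \<nu>1 T2 \<nu>2 \<longleftrightarrow> (\<exists>\<sigma>. tree_isomorphism \<sigma> T1 \<nu>1 T2 \<nu>2)"

end

theory Submission
  imports Defs
begin

text \<open>
  In a maximal primitive factorization tree the label of a vertex determines the set of labels of
  its children, and siblings carry distinct labels. Hence matching the two roots and then, level by
  level, children with equal labels of matched vertices is an isomorphism.
\<close>

section \<open>Rooted trees\<close>

lemma rooted_tree_unique_walk:
  assumes "rooted_tree T r0" "v \<in> pverts T"
    "pre_digraph.awalk (with_proj T) r0 p v" "pre_digraph.awalk (with_proj T) r0 q v"
  shows "p = q"
  using assms unfolding rooted_tree_def by blast

lemma rooted_tree_arcD:
  assumes "rooted_tree T r0" "(u, v) \<in> parcs T"
  shows "u \<in> pverts T" "v \<in> pverts T"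
proof -
  interpret pair_wf_digraph T
    using assms(1) unfolding rooted_tree_def by blast
  show "u \<in> pverts T" "v \<in> pverts T"
    using in_arcsD1[OF assms(2)] in_arcsD2[OF assms(2)] by blast+
qed

lemma rooted_tree_walk_snoc:
  assumes "rooted_tree T r0" "(u, v) \<in> parcs T"
  obtains p where "pre_digraph.awalk (with_proj T) r0 (p @ [(u, v)]) v"
proof -
  interpret pair_wf_digraph T
    using assms(1) unfolding rooted_tree_def by blast
  from assms(1) rooted_tree_arcD[OF assms] obtain p where "awalk r0 p u"
    unfolding rooted_tree_def by blast
  moreover have "awalk u [(u, v)] v"
    using arc_implies_awalk[of "(u, v)"] assms(2) by simp
  ultimately show thesis
    using that awalk_appendI by blast
qed

text \<open>An arc into the root would end a nonempty walk from the root to itself, competing with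
  the empty walk.\<close>

lemma rooted_tree_no_arc_to_root:
  assumes "rooted_tree T r0"
  shows "(u, r0) \<notin> parcs T"
proof
  assume arc: "(u, r0) \<in> parcs T"
  interpret pair_wf_digraph T
    using assms unfolding rooted_tree_def by blast
  from rooted_tree_walk_snoc[OF assms arc] obtain p where "awalk r0 (p @ [(u, r0)]) r0" .
  moreover have root: "r0 \<in> pverts T"
    using assms unfolding rooted_tree_def by blast
  then have "awalk r0 [] r0"
    by (simp add: awalk_Nil_iff)
  ultimately have "p @ [(u, r0)] = []"
    by (rule rooted_tree_unique_walk[OF assms root])
  then show False by simp
qed

text \<open>Each arc into \<open>v\<close> is the last arc of some walk from the root to
  \<open>v\<close>, and there is only one such walk.\<close>

lemma rooted_tree_unique_parent:
  assumes "rooted_tree T r0" "(u, v) \<in> parcs T" "(u', v) \<in> parcs T"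
  shows "u = u'"
proof -
  from rooted_tree_walk_snoc[OF assms(1,2)] obtain p
    where p: "pre_digraph.awalk (with_proj T) r0 (p @ [(u, v)]) v" .
  from rooted_tree_walk_snoc[OF assms(1,3)] obtain q
    where q: "pre_digraph.awalk (with_proj T) r0 (q @ [(u', v)]) v" .
  show ?thesis
    using rooted_tree_unique_walk[OF assms(1) rooted_tree_arcD(2)[OF assms(1,2)] p q] by simp
qed

lemma parent_eq:
  assumes "rooted_tree T r0" "(u, v) \<in> parcs T"
  shows "parent T v = u"
  unfolding parent_def using assms(2) rooted_tree_unique_parent[OF assms(1)] by blast

text \<open>The property travels along the walk from the root to \<open>v\<close>. Walks are finite
  lists, so the tree itself may be infinite.\<close>

lemma rooted_tree_induct [consumes 2, case_names root arc]:
  assumes tree: "rooted_tree T r0" and v: "v \<in> pverts T"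
    and root: "P r0"
    and arc: "\<And>u w. \<lbrakk>(u, w) \<in> parcs T; P u\<rbrakk> \<Longrightarrow> P w"
  shows "P v"
proof -
  interpret pair_wf_digraph T
    using tree unfolding rooted_tree_def by blast
  have step: "awalk u p w \<Longrightarrow> P u \<Longrightarrow> P w" for u p w
  proof (induction p arbitrary: u)
    case Nil
    then show ?case by (simp add: awalk_Nil_iff)
  next
    case (Cons e p)
    then show ?case
      using arc[of "fst e" "snd e"] by (auto simp: awalk_Cons_iff)
  qed
  from tree v obtain p where "awalk r0 p v"
    unfolding rooted_tree_def by blast
  with step root show ?thesis by blast
qed

section \<open>Trees whose labels determine the labels of the children\<close>

text \<open>Keeps only what the isomorphism needs: the rule \<open>D\<close> gives the labels of the
  children, and injectivity lets a label single out one child.\<close>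

definition branching_tree ::
  "('x \<Rightarrow> 'x set) \<Rightarrow> 'x \<Rightarrow> 'v pair_pre_digraph \<Rightarrow> 'v \<Rightarrow> ('v \<Rightarrow> 'x) \<Rightarrow> bool" where
  "branching_tree D x0 T r \<nu> \<longleftrightarrow>
     rooted_tree T r \<and> \<nu> r = x0 \<and>
     (\<forall>v\<in>pverts T. inj_on \<nu> (children T v) \<and> \<nu> ` children T v = D (\<nu> v))"

text \<open>A relation rather than a recursive function, so that the two trees play symmetric roles:
  each fact about it also holds for its converse.\<close>

inductive matched ::
  "'v pair_pre_digraph \<Rightarrow> 'v \<Rightarrow> ('v \<Rightarrow> 'x) \<Rightarrow> 'w pair_pre_digraph \<Rightarrow> 'w \<Rightarrow> ('w \<Rightarrow> 'x) \<Rightarrow>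
    'v \<Rightarrow> 'w \<Rightarrow> bool"
  for T1 r1 \<nu>1 T2 r2 \<nu>2 where
  root: "matched T1 r1 \<nu>1 T2 r2 \<nu>2 r1 r2"
| child: "\<lbrakk>matched T1 r1 \<nu>1 T2 r2 \<nu>2 v w; (v, v') \<in> parcs T1; (w, w') \<in> parcs T2; \<nu>1 v' = \<nu>2 w'\<rbrakk>
    \<Longrightarrow> matched T1 r1 \<nu>1 T2 r2 \<nu>2 v' w'"

lemma matched_sym:
  "matched T1 r1 \<nu>1 T2 r2 \<nu>2 v w \<Longrightarrow> matched T2 r2 \<nu>2 T1 r1 \<nu>1 w v"
  by (induction rule: matched.induct) (auto intro: matched.intros)

lemma matchedD:
  assumes "matched T1 r1 \<nu>1 T2 r2 \<nu>2 v w"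
    "branching_tree D x0 T1 r1 \<nu>1" "branching_tree D x0 T2 r2 \<nu>2"
  shows "w \<in> pverts T2" "\<nu>2 w = \<nu>1 v"
proof -
  have tree: "rooted_tree T2 r2" and labels: "\<nu>1 r1 = \<nu>2 r2"
    using assms(2,3) unfolding branching_tree_def by auto
  then have "r2 \<in> pverts T2"
    unfolding rooted_tree_def by blast
  with assms(1) show "w \<in> pverts T2"
    by (cases rule: matched.cases) (auto dest: rooted_tree_arcD(2)[OF tree])
  from assms(1) labels show "\<nu>2 w = \<nu>1 v"
    by (cases rule: matched.cases) simp_all
qed

text \<open>By induction on the first derivation. The second must end with the same rule, since the
  root has no incoming arc, and must start from the same parent, since parents are unique.\<close>

lemma matched_unique:
  assumes "matched T1 r1 \<nu>1 T2 r2 \<nu>2 v w" "matched T1 r1 \<nu>1 T2 r2 \<nu>2 v w'"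
    "branching_tree D x0 T1 r1 \<nu>1" "branching_tree D x0 T2 r2 \<nu>2"
  shows "w = w'"
proof -
  have no_arc: "(u, r1) \<notin> parcs T1" for u
    using assms(3) rooted_tree_no_arc_to_root unfolding branching_tree_def by metis
  from assms(1,2) show ?thesis
  proof (induction arbitrary: w' rule: matched.induct)
    case root
    then show ?case
      by (cases rule: matched.cases) (simp_all add: no_arc)
  next
    case (child v w v' w1)
    from child.prems show ?case
    proof (cases rule: matched.cases)
      case root
      then show ?thesis
        using child.hyps(2) no_arc by blast
    next
      case (child v2 w2)
      have "v2 = v"
        using child(2) child.hyps(2) assms(3) rooted_tree_unique_parent
        unfolding branching_tree_def by metis
      then have "w2 = w"
        using child.IH child(1) by blast
      \<comment> \<open>Both candidates are now siblings carrying the label of \<open>v'\<close>, so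
        injectivity on \<open>children T2 w\<close> identifies them.\<close>
      then have "w1 \<in> children T2 w" "w' \<in> children T2 w" "w \<in> pverts T2"
        using child.hyps(3) child(3) assms(4) rooted_tree_arcD(1)
        unfolding children_def branching_tree_def by fastforce+
      then show ?thesis
        using assms(4) child.hyps(4) child(4) unfolding branching_tree_def inj_on_def by metis
    qed
  qed
qed

lemma matched_total:
  assumes "v \<in> pverts T1" "branching_tree D x0 T1 r1 \<nu>1" "branching_tree D x0 T2 r2 \<nu>2"
  shows "\<exists>w. matched T1 r1 \<nu>1 T2 r2 \<nu>2 v w"
proof -
  have tree: "rooted_tree T1 r1"
    using assms(2) unfolding branching_tree_def by blast
  from tree assms(1) show ?thesis
  proof (induction rule: rooted_tree_induct)
    case root
    show ?case by (rule exI) (rule matched.root)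
  next
    case (arc u v)
    then obtain w where w: "matched T1 r1 \<nu>1 T2 r2 \<nu>2 u w" by blast
    have "\<nu>1 v \<in> \<nu>1 ` children T1 u"
      using arc(1) unfolding children_def by blast
    \<comment> \<open>Both sides are \<open>D\<close> applied to the common label of
      \<open>u\<close> and \<open>w\<close>.\<close>
    also have "\<dots> = \<nu>2 ` children T2 w"
      using assms(2,3) matchedD[OF w assms(2,3)] rooted_tree_arcD(1)[OF tree arc(1)]
      unfolding branching_tree_def by metis
    finally obtain w' where "(w, w') \<in> parcs T2" "\<nu>1 v = \<nu>2 w'"
      unfolding children_def by blast
    with matched.child[OF w arc(1)] show ?case by blast
  qed
qed

text \<open>The derivation for \<open>v'\<close> and \<open>w'\<close> passes through a partner of
  the parent of \<open>v'\<close>. That parent is \<open>v\<close>, whose only partner is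
  \<open>w\<close>.\<close>

lemma matched_arc:
  assumes "matched T1 r1 \<nu>1 T2 r2 \<nu>2 v w" "matched T1 r1 \<nu>1 T2 r2 \<nu>2 v' w'" "(v, v') \<in> parcs T1"
    "branching_tree D x0 T1 r1 \<nu>1" "branching_tree D x0 T2 r2 \<nu>2"
  shows "(w, w') \<in> parcs T2"
  using assms(2)
proof (cases rule: matched.cases)
  case root
  then show ?thesis
    using assms(3,4) rooted_tree_no_arc_to_root unfolding branching_tree_def by metis
next
  case (child u z)
  then have "u = v"
    using assms(3,4) rooted_tree_unique_parent unfolding branching_tree_def by metis
  with child matched_unique[OF _ assms(1,4,5)] show ?thesis by blast
qed

theorem branching_tree_isomorphic:
  assumes "branching_tree D x0 T1 r1 \<nu>1" "branching_tree D x0 T2 r2 \<nu>2"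
  shows "tree_isomorphic T1 \<nu>1 T2 \<nu>2"
proof -
  let ?M = "matched T1 r1 \<nu>1 T2 r2 \<nu>2"
  obtain \<sigma> where \<sigma>: "?M v (\<sigma> v)" if "v \<in> pverts T1" for v
    using matched_total[OF _ assms] by metis
  have "bij_betw \<sigma> (pverts T1) (pverts T2)"
  proof (rule bij_betw_imageI)
    show "inj_on \<sigma> (pverts T1)"
      \<comment> \<open>Injectivity is uniqueness of partners for the converse relation;
        surjectivity below is its totality.\<close>
      by (rule inj_onI) (metis \<sigma> matched_sym matched_unique[OF _ _ assms(2,1)])
    have "w \<in> \<sigma> ` pverts T1" if w: "w \<in> pverts T2" for w
    proof -
      from matched_total[OF w assms(2,1)] obtain v where v: "matched T2 r2 \<nu>2 T1 r1 \<nu>1 w v"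
        by blast
      then have "v \<in> pverts T1"
        by (rule matchedD(1)[OF _ assms(2,1)])
      with matched_unique[OF matched_sym[OF v] \<sigma> assms] show ?thesis by blast
    qed
    then show "\<sigma> ` pverts T1 = pverts T2"
      using \<sigma> matchedD(1)[OF _ assms] by blast
  qed
  moreover have "\<nu>2 (\<sigma> v) = \<nu>1 v" if "v \<in> pverts T1" for v
    using \<sigma>[OF that] by (rule matchedD(2)[OF _ assms])
  moreover have "(g, h) \<in> parcs T1 \<longleftrightarrow> (\<sigma> g, \<sigma> h) \<in> parcs T2"
    if "g \<in> pverts T1" "h \<in> pverts T1" for g h
    using \<sigma>[OF that(1)] \<sigma>[OF that(2)] matched_arc[OF _ _ _ assms]
      matched_arc[OF matched_sym matched_sym _ assms(2,1)] by blast
  ultimately show ?thesis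
    unfolding tree_isomorphic_def tree_isomorphism_def by blast
qed

section \<open>Factorization trees\<close>

text \<open>
  The choice of \<open>n\<close> is harmless: \<open>maximal_primitive_factorization_tree\<close> constrains the children
  for every admissible \<open>n\<close>.
\<close>

definition child_labels :: "rat \<Rightarrow> fac \<Rightarrow> fac set" where
  "child_labels \<alpha> A =
     (if \<exists>n<num_primes \<alpha>. is_factorization (partial_rat \<alpha> n) A
      then Delta \<alpha> (SOME n. n < num_primes \<alpha> \<and> is_factorization (partial_rat \<alpha> n) A) A
      else {})"

lemma maximal_primitive_branching_tree:
  assumes "maximal_primitive_factorization_tree \<alpha> T r \<nu>"
  shows "branching_tree (child_labels \<alpha>) (\<lambda>_. (1, 1)) T r \<nu>"
proof -
  have ft: "factorization_tree \<alpha> T r \<nu>"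
    using assms unfolding maximal_primitive_factorization_tree_def by blast
  then have tree: "rooted_tree T r" and root: "\<nu> r = (\<lambda>_. (1, 1))"
    unfolding factorization_tree_def tree_data_structure_def by blast+
  \<comment> \<open>Translates arcs into the language of non-root vertices and
    \<open>parent\<close>, in which the sibling and subfactorization conditions are stated.\<close>
  have child: "s \<in> pverts T - {r} \<and> parent T s = v" if "s \<in> children T v" for s v
    using that rooted_tree_arcD(2)[OF tree] rooted_tree_no_arc_to_root[OF tree] parent_eq[OF tree]
    unfolding children_def by blast
  have "inj_on \<nu> (children T v)" for v
    using ft child unfolding factorization_tree_def inj_on_def by metis
  moreover have "\<nu> ` children T v = child_labels \<alpha> (\<nu> v)" if v: "v \<in> pverts T" for v
  proof (cases "\<exists>n<num_primes \<alpha>. is_factorization (partial_rat \<alpha> n) (\<nu> v)")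
    case True
    define n where "n = (SOME n. n < num_primes \<alpha> \<and> is_factorization (partial_rat \<alpha> n) (\<nu> v))"
    have n: "n < num_primes \<alpha>" "is_factorization (partial_rat \<alpha> n) (\<nu> v)"
      using someI_ex[OF True] unfolding n_def by auto
    \<comment> \<open>Maximality speaks only of non-leaf vertices; the requirement that such a
      vertex has a child makes it applicable.\<close>
    then have "children T v \<noteq> {}"
      using ft v unfolding factorization_tree_def by blast
    then have "\<nu> ` children T v = Delta \<alpha> n (\<nu> v)"
      using assms v n unfolding maximal_primitive_factorization_tree_def by blast
    then show ?thesis
      using True unfolding child_labels_def n_def by simp
  next
    case False
    \<comment> \<open>A child would make \<open>\<nu> v\<close> a direct subfactorization, hence a
      factorization of some \<open>partial_rat \<alpha> n\<close> with
      \<open>n < num_primes \<alpha>\<close>.\<close>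
    have "s \<notin> children T v" for s
    proof
      assume "s \<in> children T v"
      then have "direct_subfactorization \<alpha> (\<nu> v) (\<nu> s)"
        using ft child unfolding factorization_tree_def by metis
      then show False
        using False unfolding direct_subfactorization_def by blast
    qed
    with False show ?thesis
      unfolding child_labels_def by auto
  qed
  ultimately show ?thesis
    using tree root unfolding branching_tree_def by blast
qed

theorem theorem2p5:
  fixes \<alpha> :: rat
    and T1 :: "'v pair_pre_digraph" and r1 :: 'v and \<nu>1 :: "'v \<Rightarrow> fac"
    and T2 :: "'w pair_pre_digraph" and r2 :: 'w and \<nu>2 :: "'w \<Rightarrow> fac"
  assumes "\<alpha> > 0"
    and "maximal_primitive_factorization_tree \<alpha> T1 r1 \<nu>1"
    and "maximal_primitive_factorization_tree \<alpha> T2 r2 \<nu>2"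
  shows "tree_isomorphic T1 \<nu>1 T2 \<nu>2"
  using assms(2,3)[THEN maximal_primitive_branching_tree] by (rule branching_tree_isomorphic)

end
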